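(* $\widehat{(\mathrm{M\ddot{o}b})}^4$ is the symmetry group of the non-autonomous difference equations $\widehat Q=0$ obtained on the lattice $\mathbb{Z}^2$ (by the four-color construction described in the context) from the trapezoidal $H^4$ and the $H^6$ quad equations $Q=0$ listed in the context; it is obtained by the "non-autonomous lifting" of $(\mathrm{M\ddot{o}b})^4$, the symmetry group of those quad equations. That is, $\widehat{(\mathrm{M\ddot{o}b})}^4$ is a group, and acting with it gives the same result as lifting: transforming a quad equation $Q$ of the list by $M\in(\mathrm{M\ddot{o}b})^4$ and then constructing the non-autonomous lattice equation is the same as first constructing the non-autonomous lattice equation $\widehat Q$ and then transforming it by the non-autonomous lifting $\widehat M\in\widehat{(\mathrm{M\ddot{o}b})}^4$ of $M$, i.e. $\widehat{M(Q)}\equiv\widehat M(\widehat Q)$.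
   Context: $(\mathrm{M\ddot{o}b})^4$ is the group of transformations $M\colon(x,x_1,x_2,x_{12})\mapsto\left(\frac{a_0x+b_0}{c_0x+d_0},\frac{a_1x_1+b_1}{c_1x_1+d_1},\frac{a_2x_2+b_2}{c_2x_2+d_2},\frac{a_{12}x_{12}+b_{12}}{c_{12}x_{12}+d_{12}}\right)$ with complex coefficients, $a_id_i-b_ic_i\neq0$ for $i=0,1,2,12$, each set of coefficients being defined up to a common factor. "Symmetry group" is meant in the sense of the group of transformations up to which the equations are classified. Weights on $\mathbb{Z}^2$: $f_{n,m}=\frac{1+(-1)^n+(-1)^m+(-1)^{n+m}}{4}$, ${|f}_{n,m}=\frac{1-(-1)^n+(-1)^m-(-1)^{n+m}}{4}$, $\underline f_{n,m}=\frac{1+(-1)^n-(-1)^m-(-1)^{n+m}}{4}$, ${|\underline f}_{n,m}=\frac{1-(-1)^n-(-1)^m+(-1)^{n+m}}{4}$. The non-autonomous lifting of $M$ is the transformation of the field $u_{n,m}$ $$\widehat M=M_{n,m}\colon u_{n,m}\mapsto f_{n,m}\frac{a_0u_{n,m}+b_0}{c_0u_{n,m}+d_0}+{|f}_{n,m}\frac{a_1u_{n,m}+b_1}{c_1u_{n,m}+d_1}+\underline f_{n,m}\frac{a_2u_{n,m}+b_2}{c_2u_{n,m}+d_2}+{|\underline f}_{n,m}\frac{a_{12}u_{n,m}+b_{12}}{c_{12}u_{n,m}+d_{12}},$$ and $\widehat{(\mathrm{M\ddot{o}b})}^4$ is the set of all these transformations, with composition as the operation. Lattice equation of a quad equation $Q(x,x_1,x_2,x_{12})=0$,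 where $Q$ is affine linear in each field: put ${|Q}(x,x_1,x_2,x_{12})=Q(x_1,x,x_{12},x_2)$, $\underline Q(x,x_1,x_2,x_{12})=Q(x_2,x_{12},x,x_1)$, ${|\underline Q}(x,x_1,x_2,x_{12})=Q(x_{12},x_2,x_1,x)$; then $$\widehat Q=f_{n,m}Q+{|f}_{n,m}\,{|Q}+\underline f_{n,m}\,\underline Q+{|\underline f}_{n,m}\,{|\underline Q},$$ all evaluated at $(u_{n,m},u_{n+1,m},u_{n,m+1},u_{n+1,m+1})$. $M(Q)$ is $Q$ with its fields transformed by $M$, and $\widehat M(\widehat Q)$ is $\widehat Q$ with each $u_{n+r,m+s}$, $r,s\in\{0,1\}$, replaced by $M_{n+r,m+s}(u_{n+r,m+s})$; denominators are cleared. The quad equations considered (fields written uniformly as $x,x_1,x_2,x_{12}$, with $x$ at the origin of a square, $x_1,x_2$ its two neighbours, $x_{12}$ the opposite vertex; Greek letters are complex parameters) are: ${}_tH_1^\epsilon$: $(x-x_1)(x_2-x_{12})-\alpha_2(1+\epsilon^2x_2x_{12})=0$; ${}_tH_2^\epsilon$: $(x-x_1)(x_2-x_{12})+\alpha_2(x+x_1+x_2+x_{12})+\frac{\epsilon\alpha_2}{2}(2x_2+2\alpha_3+\alpha_2)(2x_{12}+2\alpha_3+\alpha_2)+(\alpha_2+\alpha_3)^2-\alpha_3^2+\frac{\epsilon\alpha_2^3}{2}=0$; ${}_tH_3^\epsilon$: $e^{2\alpha_2}(xx_{12}+x_1x_2)-(xx_2+x_1x_{12})-e^{2\alpha_3}(e^{4\alpha_2}-1)\left(\delta^2+\frac{\epsilon^2x_2x_{12}}{e^{4\alpha_3+2\alpha_2}}\right)=0$;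 $D_1$: $x+x_1+x_2+x_{12}=0$; ${}_1D_2$: $\delta_2x+x_1+(1-\delta_1)x_2+x_{12}(x+\delta_1x_2)=0$; $D_3$: $x+x_1x_2+x_1x_{12}+x_2x_{12}=0$; ${}_1D_4$: $xx_{12}+x_1x_2+\delta_1x_1x_{12}+\delta_2x_2x_{12}+\delta_3=0$; ${}_2D_2$: $\delta_2x+(1-\delta_1)x_2+x_{12}+x_1(x+\delta_1x_2-\delta_1\lambda)-\delta_1\delta_2\lambda=0$; ${}_3D_2$: $\delta_2x+x_2+(1-\delta_1)x_{12}+x_1(x+\delta_1x_{12}-\delta_1\lambda)-\delta_1\delta_2\lambda=0$; ${}_2D_4$: $xx_1+\delta_2x_1x_2+\delta_1x_1x_{12}+x_2x_{12}+\delta_3=0$. *)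

theory Defs
  imports Complex_Main "HOL-Algebra.Group"
begin

(* The Riemann sphere.  Moebius transformations are bijections of it, so that they form a group
   under composition of functions. *)

datatype riemann_sphere = Fin complex | Infty

type_synonym moebius_coeffs = "complex \<times> complex \<times> complex \<times> complex"

fun nondeg :: "moebius_coeffs \<Rightarrow> bool" where
  "nondeg (a, b, c, d) \<longleftrightarrow> a * d - b * c \<noteq> 0"

fun numer :: "moebius_coeffs \<Rightarrow> complex \<Rightarrow> complex" where
  "numer (a, b, c, d) z = a * z + b"

fun denom :: "moebius_coeffs \<Rightarrow> complex \<Rightarrow> complex" where
  "denom (a, b, c, d) z = c * z + d"

fun moebius :: "moebius_coeffs \<Rightarrow> riemann_sphere \<Rightarrow> riemann_sphere" where
  "moebius (a, b, c, d) (Fin z) =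
     (if c * z + d = 0 then Infty else Fin ((a * z + b) / (c * z + d)))"
| "moebius (a, b, c, d) Infty = (if c = 0 then Infty else Fin (a / c))"

definition Moeb :: "(riemann_sphere \<Rightarrow> riemann_sphere) set" where
  "Moeb = {moebius A | A. nondeg A}"

definition map4 ::
  "(riemann_sphere \<Rightarrow> riemann_sphere) \<Rightarrow> (riemann_sphere \<Rightarrow> riemann_sphere) \<Rightarrow>
   (riemann_sphere \<Rightarrow> riemann_sphere) \<Rightarrow> (riemann_sphere \<Rightarrow> riemann_sphere) \<Rightarrow>
   riemann_sphere \<times> riemann_sphere \<times> riemann_sphere \<times> riemann_sphere \<Rightarrow>
   riemann_sphere \<times> riemann_sphere \<times> riemann_sphere \<times> riemann_sphere" where
  "map4 M0 M1 M2 M12 = (\<lambda>(x, x1, x2, x12). (M0 x, M1 x1, M2 x2, M12 x12))"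

definition Moeb4 ::
  "(riemann_sphere \<times> riemann_sphere \<times> riemann_sphere \<times> riemann_sphere \<Rightarrow>
    riemann_sphere \<times> riemann_sphere \<times> riemann_sphere \<times> riemann_sphere) monoid" where
  "Moeb4 = \<lparr>carrier = {map4 M0 M1 M2 M12 | M0 M1 M2 M12.
                        M0 \<in> Moeb \<and> M1 \<in> Moeb \<and> M2 \<in> Moeb \<and> M12 \<in> Moeb},
            monoid.mult = (\<circ>), one = id\<rparr>"


(* The weights are the indicators of (n, m) being (even, even), (odd, even), (even, odd),
   (odd, odd), in this order. *)

definition wt0 :: "int \<Rightarrow> int \<Rightarrow> complex" where
  "wt0 n m = (1 + (-1) powi n + (-1) powi m + (-1) powi (n + m)) / 4"

definition wt1 :: "int \<Rightarrow> int \<Rightarrow> complex" where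
  "wt1 n m = (1 - (-1) powi n + (-1) powi m - (-1) powi (n + m)) / 4"

definition wt2 :: "int \<Rightarrow> int \<Rightarrow> complex" where
  "wt2 n m = (1 + (-1) powi n - (-1) powi m - (-1) powi (n + m)) / 4"

definition wt12 :: "int \<Rightarrow> int \<Rightarrow> complex" where
  "wt12 n m = (1 - (-1) powi n - (-1) powi m + (-1) powi (n + m)) / 4"


(* Weighted sums on the sphere, with the convention 0 * Infty = 0: a summand with weight 0 does
   not contribute, even where its Moebius transformation has its pole. *)

fun sphere_scale :: "complex \<Rightarrow> riemann_sphere \<Rightarrow> riemann_sphere"  (infixr "*\<^sub>S" 75) where
  "w *\<^sub>S Fin z = Fin (w * z)"
| "w *\<^sub>S Infty = (if w = 0 then Fin 0 else Infty)"

fun sphere_add :: "riemann_sphere \<Rightarrow> riemann_sphere \<Rightarrow> riemann_sphere"  (infixl "+\<^sub>S" 65) where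
  "Fin z +\<^sub>S Fin w = Fin (z + w)"
| "Infty +\<^sub>S q = Infty"
| "p +\<^sub>S Infty = Infty"

type_synonym lattice_field = "int \<Rightarrow> int \<Rightarrow> riemann_sphere"

definition lift ::
  "(riemann_sphere \<Rightarrow> riemann_sphere) \<Rightarrow> (riemann_sphere \<Rightarrow> riemann_sphere) \<Rightarrow>
   (riemann_sphere \<Rightarrow> riemann_sphere) \<Rightarrow> (riemann_sphere \<Rightarrow> riemann_sphere) \<Rightarrow>
   lattice_field \<Rightarrow> lattice_field" where
  "lift M0 M1 M2 M12 = (\<lambda>u n m.
     wt0 n m *\<^sub>S M0 (u n m) +\<^sub>S wt1 n m *\<^sub>S M1 (u n m) +\<^sub>S
     wt2 n m *\<^sub>S M2 (u n m) +\<^sub>S wt12 n m *\<^sub>S M12 (u n m))"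

definition Moeb4_hat :: "(lattice_field \<Rightarrow> lattice_field) monoid" where
  "Moeb4_hat = \<lparr>carrier = {lift M0 M1 M2 M12 | M0 M1 M2 M12.
                            M0 \<in> Moeb \<and> M1 \<in> Moeb \<and> M2 \<in> Moeb \<and> M12 \<in> Moeb},
                monoid.mult = (\<circ>), one = id\<rparr>"


(* A quad equation Q = 0 is given by its left-hand side, a function of (x, x1, x2, x12).
   Functions that are affine in each argument are the same as multilinear polynomials. *)

type_synonym quad = "complex \<Rightarrow> complex \<Rightarrow> complex \<Rightarrow> complex \<Rightarrow> complex"

definition affine_fun :: "(complex \<Rightarrow> complex) \<Rightarrow> bool" where
  "affine_fun f \<longleftrightarrow> (\<exists>p q. \<forall>z. f z = p * z + q)"

definition affine_linear :: "quad \<Rightarrow> bool" where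
  "affine_linear Q \<longleftrightarrow>
     (\<forall>x1 x2 x12. affine_fun (\<lambda>x. Q x x1 x2 x12)) \<and>
     (\<forall>x x2 x12. affine_fun (\<lambda>x1. Q x x1 x2 x12)) \<and>
     (\<forall>x x1 x12. affine_fun (\<lambda>x2. Q x x1 x2 x12)) \<and>
     (\<forall>x x1 x2. affine_fun (\<lambda>x12. Q x x1 x2 x12))"

(* A lattice equation: at (n, m) the arguments stand for
   u n m, u (n + 1) m, u n (m + 1), u (n + 1) (m + 1). *)

type_synonym lattice_eq = "int \<Rightarrow> int \<Rightarrow> quad"

definition lattice_equation :: "quad \<Rightarrow> lattice_eq" where
  "lattice_equation Q = (\<lambda>n m x x1 x2 x12.
     wt0 n m * Q x x1 x2 x12 + wt1 n m * Q x1 x x12 x2 +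
     wt2 n m * Q x2 x12 x x1 + wt12 n m * Q x12 x2 x1 x)"


(* P is Q with x, x1, x2, x12 replaced by their images under the Moebius transformations
   M0, M1, M2, M12, denominators being cleared.  The coefficients of the Mi are determined up to
   a common factor only, and so P is determined by the Mi and Q up to a nonzero factor.
   As P is a polynomial, it is determined by its values off the zeros of the denominators. *)

definition substituted ::
  "(riemann_sphere \<Rightarrow> riemann_sphere) \<Rightarrow> (riemann_sphere \<Rightarrow> riemann_sphere) \<Rightarrow>
   (riemann_sphere \<Rightarrow> riemann_sphere) \<Rightarrow> (riemann_sphere \<Rightarrow> riemann_sphere) \<Rightarrow>
   quad \<Rightarrow> quad \<Rightarrow> bool" where
  "substituted M0 M1 M2 M12 Q P \<longleftrightarrow> affine_linear P \<and>
     (\<exists>A0 A1 A2 A12.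
        nondeg A0 \<and> nondeg A1 \<and> nondeg A2 \<and> nondeg A12 \<and>
        M0 = moebius A0 \<and> M1 = moebius A1 \<and> M2 = moebius A2 \<and> M12 = moebius A12 \<and>
        (\<forall>x x1 x2 x12.
           denom A0 x \<noteq> 0 \<longrightarrow> denom A1 x1 \<noteq> 0 \<longrightarrow> denom A2 x2 \<noteq> 0 \<longrightarrow> denom A12 x12 \<noteq> 0 \<longrightarrow>
           P x x1 x2 x12 =
             denom A0 x * denom A1 x1 * denom A2 x2 * denom A12 x12 *
             Q (numer A0 x / denom A0 x) (numer A1 x1 / denom A1 x1)
               (numer A2 x2 / denom A2 x2) (numer A12 x12 / denom A12 x12)))"

(* P = T(Q) for a transformation T of the four fields of a cell *)

definition quad_transformed ::
  "(riemann_sphere \<times> riemann_sphere \<times> riemann_sphere \<times> riemann_sphere \<Rightarrow>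
    riemann_sphere \<times> riemann_sphere \<times> riemann_sphere \<times> riemann_sphere) \<Rightarrow>
   quad \<Rightarrow> quad \<Rightarrow> bool" where
  "quad_transformed T Q P \<longleftrightarrow>
     (\<exists>M0 M1 M2 M12. T = map4 M0 M1 M2 M12 \<and> substituted M0 M1 M2 M12 Q P)"

(* E' = T(E) for a transformation T of the lattice field, which sends u n m to L n m (u n m);
   these local maps L n m are determined by T. *)

definition lattice_transformed ::
  "(lattice_field \<Rightarrow> lattice_field) \<Rightarrow> lattice_eq \<Rightarrow> lattice_eq \<Rightarrow> bool" where
  "lattice_transformed T E E' \<longleftrightarrow>
     (\<exists>L. T = (\<lambda>u n m. L n m (u n m)) \<and>
          (\<forall>n m. substituted (L n m) (L (n + 1) m) (L n (m + 1)) (L (n + 1) (m + 1))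
                    (E n m) (E' n m)))"

(* Equality of lattice equations, whose left-hand sides matter only up to a nonvanishing factor *)

definition same_lattice_eq :: "lattice_eq \<Rightarrow> lattice_eq \<Rightarrow> bool" where
  "same_lattice_eq E E' \<longleftrightarrow>
     (\<exists>k. \<forall>n m. k n m \<noteq> 0 \<and> (\<forall>x x1 x2 x12. E n m x x1 x2 x12 = k n m * E' n m x x1 x2 x12))"


(* The relations "equal up to a transformation of the group", by which quad equations and
   lattice equations are classified *)

definition quad_equivalence :: "(quad \<times> quad) set" where
  "quad_equivalence = {(Q, P). affine_linear Q \<and> affine_linear P \<and>
     (\<exists>T\<in>carrier Moeb4. quad_transformed T Q P)}"

definition lattice_equivalence :: "(lattice_eq \<times> lattice_eq) set" where
  "lattice_equivalence = {(E, E'). (\<forall>n m. affine_linear (E n m)) \<and> (\<forall>n m. affine_linear (E' n m)) \<and>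
     (\<exists>T\<in>carrier Moeb4_hat. lattice_transformed T E E')}"


(* The trapezoidal H4 equations and the H6 equations; D2_1 is the equation usually written with
   a left subscript 1, and similarly for the others. *)

definition tH1 :: "complex \<Rightarrow> complex \<Rightarrow> quad" where
  "tH1 \<epsilon> \<alpha>2 = (\<lambda>x x1 x2 x12.
     (x - x1) * (x2 - x12) - \<alpha>2 * (1 + \<epsilon>^2 * x2 * x12))"

definition tH2 :: "complex \<Rightarrow> complex \<Rightarrow> complex \<Rightarrow> quad" where
  "tH2 \<epsilon> \<alpha>2 \<alpha>3 = (\<lambda>x x1 x2 x12.
     (x - x1) * (x2 - x12) + \<alpha>2 * (x + x1 + x2 + x12)
     + \<epsilon> * \<alpha>2 / 2 * (2 * x2 + 2 * \<alpha>3 + \<alpha>2) * (2 * x12 + 2 * \<alpha>3 + \<alpha>2)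
     + (\<alpha>2 + \<alpha>3)^2 - \<alpha>3^2 + \<epsilon> * \<alpha>2^3 / 2)"

definition tH3 :: "complex \<Rightarrow> complex \<Rightarrow> complex \<Rightarrow> complex \<Rightarrow> quad" where
  "tH3 \<epsilon> \<delta> \<alpha>2 \<alpha>3 = (\<lambda>x x1 x2 x12.
     exp (2 * \<alpha>2) * (x * x12 + x1 * x2) - (x * x2 + x1 * x12)
     - exp (2 * \<alpha>3) * (exp (4 * \<alpha>2) - 1) *
       (\<delta>^2 + \<epsilon>^2 * x2 * x12 / exp (4 * \<alpha>3 + 2 * \<alpha>2)))"

definition D1 :: quad where
  "D1 = (\<lambda>x x1 x2 x12. x + x1 + x2 + x12)"

definition D2_1 :: "complex \<Rightarrow> complex \<Rightarrow> quad" where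
  "D2_1 \<delta>1 \<delta>2 = (\<lambda>x x1 x2 x12.
     \<delta>2 * x + x1 + (1 - \<delta>1) * x2 + x12 * (x + \<delta>1 * x2))"

definition D3 :: quad where
  "D3 = (\<lambda>x x1 x2 x12. x + x1 * x2 + x1 * x12 + x2 * x12)"

definition D4_1 :: "complex \<Rightarrow> complex \<Rightarrow> complex \<Rightarrow> quad" where
  "D4_1 \<delta>1 \<delta>2 \<delta>3 = (\<lambda>x x1 x2 x12.
     x * x12 + x1 * x2 + \<delta>1 * x1 * x12 + \<delta>2 * x2 * x12 + \<delta>3)"

definition D2_2 :: "complex \<Rightarrow> complex \<Rightarrow> complex \<Rightarrow> quad" where
  "D2_2 \<delta>1 \<delta>2 l = (\<lambda>x x1 x2 x12.
     \<delta>2 * x + (1 - \<delta>1) * x2 + x12 + x1 * (x + \<delta>1 * x2 - \<delta>1 * l) - \<delta>1 * \<delta>2 * l)"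

definition D2_3 :: "complex \<Rightarrow> complex \<Rightarrow> complex \<Rightarrow> quad" where
  "D2_3 \<delta>1 \<delta>2 l = (\<lambda>x x1 x2 x12.
     \<delta>2 * x + x2 + (1 - \<delta>1) * x12 + x1 * (x + \<delta>1 * x12 - \<delta>1 * l) - \<delta>1 * \<delta>2 * l)"

definition D4_2 :: "complex \<Rightarrow> complex \<Rightarrow> complex \<Rightarrow> quad" where
  "D4_2 \<delta>1 \<delta>2 \<delta>3 = (\<lambda>x x1 x2 x12.
     x * x1 + \<delta>2 * x1 * x2 + \<delta>1 * x1 * x12 + x2 * x12 + \<delta>3)"

definition quad_equations :: "quad set" where
  "quad_equations =
     {tH1 \<epsilon> \<alpha>2 | \<epsilon> \<alpha>2. True} \<union> {tH2 \<epsilon> \<alpha>2 \<alpha>3 | \<epsilon> \<alpha>2 \<alpha>3. True} \<union>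
     {tH3 \<epsilon> \<delta> \<alpha>2 \<alpha>3 | \<epsilon> \<delta> \<alpha>2 \<alpha>3. True} \<union>
     {D1} \<union> {D2_1 \<delta>1 \<delta>2 | \<delta>1 \<delta>2. True} \<union> {D3} \<union> {D4_1 \<delta>1 \<delta>2 \<delta>3 | \<delta>1 \<delta>2 \<delta>3. True} \<union>
     {D2_2 \<delta>1 \<delta>2 l | \<delta>1 \<delta>2 l. True} \<union> {D2_3 \<delta>1 \<delta>2 l | \<delta>1 \<delta>2 l. True} \<union>
     {D4_2 \<delta>1 \<delta>2 \<delta>3 | \<delta>1 \<delta>2 \<delta>3. True}"

end

theory Submission
  imports Defs
begin

(* The lifting of M acts at each lattice point by one of the four components of M, selected by the
   parities of n and m, so lifting is compatible with composition.  Denominators are cleared by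
   homogenising an affine function f: clearing them in f(A z) gives
   (f 1 - f 0) * numer A z + f 0 * denom A z, which is affine in f, needs no exception for
   poles and turns composition of Moebius maps into multiplication of coefficient matrices.
   Hence M(Q) is a well-defined polynomial up to a factor, and at each lattice point the two orders
   of transforming and lifting differ by the same permutation of the four fields. *)

section \<open>Coefficients of Moebius transformations\<close>

text \<open>The product of 2 x 2 matrices, with \<open>(a, b)\<close> and \<open>(c, d)\<close> as
  rows.\<close>

fun mult_coeffs :: "moebius_coeffs \<Rightarrow> moebius_coeffs \<Rightarrow> moebius_coeffs" where
  "mult_coeffs (a, b, c, d) (a', b', c', d') =
     (a * a' + b * c', a * b' + b * d', c * a' + d * c', c * b' + d * d')"

fun scale_coeffs :: "complex \<Rightarrow> moebius_coeffs \<Rightarrow> moebius_coeffs" where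
  "scale_coeffs k (a, b, c, d) = (k * a, k * b, k * c, k * d)"

text \<open>The adjugate matrix divided by the determinant. Products with it are exactly the
  identity matrix, not just a scalar one, so that substituting back later returns \<open>Q\<close>
  itself.\<close>

fun inv_coeffs :: "moebius_coeffs \<Rightarrow> moebius_coeffs" where
  "inv_coeffs (a, b, c, d) =
     scale_coeffs (1 / (a * d - b * c)) (d, - b, - c, a)"

section \<open>Matrix algebra of the coefficients\<close>

lemma mult_coeffs_assoc:
  "mult_coeffs (mult_coeffs A B) C = mult_coeffs A (mult_coeffs B C)"
  by (cases A; cases B; cases C) (simp add: algebra_simps)

lemma mult_coeffs_one [simp]:
  "mult_coeffs (1, 0, 0, 1) A = A" "mult_coeffs A (1, 0, 0, 1) = A"
  by (cases A; simp)+

lemma nondeg_mult: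
  assumes "nondeg A" "nondeg B"
  shows "nondeg (mult_coeffs A B)"
proof -
  obtain a b c d where A: "A = (a, b, c, d)" by (cases A)
  obtain a' b' c' d' where B: "B = (a', b', c', d')" by (cases B)
  \<comment> \<open>Multiplicativity of the determinant.\<close>
  have "(a * a' + b * c') * (c * b' + d * d') - (a * b' + b * d') * (c * a' + d * c') =
      (a * d - b * c) * (a' * d' - b' * c')"
    by (simp add: algebra_simps)
  with assms A B show ?thesis by simp
qed

lemma nondeg_scale: "nondeg (scale_coeffs k A) \<longleftrightarrow> k \<noteq> 0 \<and> nondeg A"
proof (cases A)
  case (fields a b c d)
  have "k * a * (k * d) - k * b * (k * c) = k * k * (a * d - b * c)"
    by (simp add: algebra_simps)
  with fields show ?thesis by simp
qed

lemma nondeg_inv: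
  assumes "nondeg A"
  shows "nondeg (inv_coeffs A)"
  using assms by (cases A) (simp add: nondeg_scale algebra_simps del: scale_coeffs.simps)

lemma mult_inv_coeffs:
  assumes "nondeg A"
  shows "mult_coeffs A (inv_coeffs A) = (1, 0, 0, 1)" "mult_coeffs (inv_coeffs A) A = (1, 0, 0, 1)"
  using assms by (cases A; simp add: divide_simps; simp add: algebra_simps)+

text \<open>In homogeneous coordinates a Moebius map is a linear map of nonzero vectors
  \<open>(s, t)\<close>, where \<open>t = 0\<close> represents \<open>Infty\<close>. The poles of
  the inner and the outer map then need no separate treatment.\<close>

lemma moebius_mult:
  assumes "nondeg A" "nondeg B"
  shows "moebius (mult_coeffs A B) = moebius A \<circ> moebius B"
proof
  fix p
  obtain a b c d where A: "A = (a, b, c, d)" by (cases A)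
  obtain a' b' c' d' where B: "B = (a', b', c', d')" by (cases B)
  have dA: "a * d - b * c \<noteq> 0" and dB: "a' * d' - b' * c' \<noteq> 0"
    using assms A B by simp_all
  \<comment> \<open>The left side reads off the point represented by the image of
    \<open>(s, t)\<close> under \<open>A\<close>; it equals the value of \<open>moebius A\<close> at
    the point represented by \<open>(s, t)\<close>.\<close>
  have main: "(if c * s + d * t = 0 then Infty else Fin ((a * s + b * t) / (c * s + d * t))) =
      moebius A (if t = 0 then Infty else Fin (s / t))" if "s \<noteq> 0 \<or> t \<noteq> 0" for s t
  proof (cases "t = 0")
    case True
    with that show ?thesis by (simp add: A)
  next
    case False
    then have "c * (s / t) + d = (c * s + d * t) / t" "a * (s / t) + b = (a * s + b * t) / t"
      by (simp_all add: field_simps)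
    with False show ?thesis by (simp add: A)
  qed
  show "moebius (mult_coeffs A B) p = (moebius A \<circ> moebius B) p"
  proof (cases p)
    case (Fin z)
    \<comment> \<open>The image vector of \<open>(z, 1)\<close> under \<open>B\<close> is nonzero:
      otherwise the second column of \<open>B\<close> would be a multiple of the first and the
      determinant would vanish.\<close>
    have "a' * z + b' \<noteq> 0 \<or> c' * z + d' \<noteq> 0"
    proof (rule ccontr)
      assume "\<not> ?thesis"
      then have "b' = - (a' * z)" "d' = - (c' * z)"
        by (simp_all add: eq_neg_iff_add_eq_0 add.commute)
      with dB show False by simp
    qed
    moreover have "a * (a' * z + b') + b * (c' * z + d') = (a * a' + b * c') * z + (a * b' + b * d')"
      "c * (a' * z + b') + d * (c' * z + d') = (c * a' + d * c') * z + (c * b' + d * d')"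
      by (simp_all add: algebra_simps)
    ultimately show ?thesis using main[of "a' * z + b'" "c' * z + d'"]
      by (simp only: A B Fin mult_coeffs.simps moebius.simps comp_apply)
  next
    case Infty
    have "a' \<noteq> 0 \<or> c' \<noteq> 0" using dB by auto
    from main[OF this] show ?thesis
      by (simp only: A B Infty mult_coeffs.simps moebius.simps comp_apply)
  qed
qed

lemma moebius_one: "moebius (1, 0, 0, 1) = id"
proof
  fix p show "moebius (1, 0, 0, 1) p = id p" by (cases p) simp_all
qed

lemma moebius_scale:
  assumes "k \<noteq> 0"
  shows "moebius (scale_coeffs k A) = moebius A"
proof
  fix p
  obtain a b c d where A: "A = (a, b, c, d)" by (cases A)
  have "k * c * z + k * d = k * (c * z + d)" "k * a * z + k * b = k * (a * z + b)" for z
    by (simp_all add: algebra_simps)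
  with assms show "moebius (scale_coeffs k A) p = moebius A p"
    by (cases p) (simp_all add: A)
qed

text \<open>The quotient of the two matrices acts as the identity on the sphere, and only nonzero
  scalar matrices do that.\<close>

lemma moebius_eq_imp_scale:
  assumes "nondeg A" "nondeg B" "moebius A = moebius B"
  obtains k where "k \<noteq> 0" "B = scale_coeffs k A"
proof -
  obtain a b c d where C: "mult_coeffs (inv_coeffs A) B = (a, b, c, d)"
    by (metis prod_cases4)
  have "moebius (a, b, c, d) = moebius (inv_coeffs A) \<circ> moebius A"
    using assms by (simp flip: C add: moebius_mult nondeg_inv)
  also have "\<dots> = id"
    using assms by (metis moebius_mult moebius_one mult_inv_coeffs(2) nondeg_inv)
  finally have I: "moebius (a, b, c, d) = id" .
  have nd: "nondeg (a, b, c, d)"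
    using assms nondeg_mult nondeg_inv C by metis
  \<comment> \<open>Fixing \<open>Infty\<close>, 0 and 1 forces \<open>c = 0\<close>, then
    \<open>b = 0\<close>, then \<open>a = d\<close>.\<close>
  have c: "c = 0" using fun_cong[OF I, of Infty] by (auto split: if_splits)
  have b: "b = 0" using fun_cong[OF I, of "Fin 0"] nd c by (auto split: if_splits)
  have a: "a = d" using fun_cong[OF I, of "Fin 1"] nd c b by (auto split: if_splits)
  have "B = mult_coeffs A (mult_coeffs (inv_coeffs A) B)"
    using assms by (simp flip: mult_coeffs_assoc add: mult_inv_coeffs)
  also have "\<dots> = scale_coeffs d A"
    unfolding C a b c by (cases A) (simp add: mult.commute)
  finally show ?thesis using that[of d] nd a c by simp
qed

section \<open>Identity, composition and inverses of Moebius maps\<close>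

lemma Moeb_id: "id \<in> Moeb"
  unfolding Moeb_def
  by (rule CollectI, rule exI[of _ "(1, 0, 0, 1)"]) (simp add: moebius_one)

lemma Moeb_comp:
  assumes "M \<in> Moeb" "N \<in> Moeb"
  shows "M \<circ> N \<in> Moeb"
proof -
  obtain A B where "nondeg A" "M = moebius A" "nondeg B" "N = moebius B"
    using assms unfolding Moeb_def by auto
  then have "M \<circ> N = moebius (mult_coeffs A B)" "nondeg (mult_coeffs A B)"
    by (simp_all add: moebius_mult nondeg_mult)
  then show ?thesis unfolding Moeb_def by blast
qed

lemma Moeb_inverse:
  assumes "M \<in> Moeb"
  obtains N where "N \<in> Moeb" "N \<circ> M = id" "M \<circ> N = id"
proof -
  obtain A where A: "nondeg A" "M = moebius A"
    using assms unfolding Moeb_def by auto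
  show ?thesis
  proof
    show "moebius (inv_coeffs A) \<in> Moeb"
      using A nondeg_inv unfolding Moeb_def by blast
    show "moebius (inv_coeffs A) \<circ> M = id" "M \<circ> moebius (inv_coeffs A) = id"
      using A by (simp_all add: nondeg_inv mult_inv_coeffs moebius_one flip: moebius_mult)
  qed
qed

section \<open>The groups\<close>

lemma map4_comp:
  "map4 M0 M1 M2 M12 \<circ> map4 N0 N1 N2 N12 = map4 (M0 \<circ> N0) (M1 \<circ> N1) (M2 \<circ> N2) (M12 \<circ> N12)"
  by (auto simp: map4_def fun_eq_iff)

lemma map4_id: "map4 id id id id = id"
  by (auto simp: map4_def fun_eq_iff)

lemma map4_inject:
  "map4 M0 M1 M2 M12 = map4 N0 N1 N2 N12 \<longleftrightarrow> M0 = N0 \<and> M1 = N1 \<and> M2 = N2 \<and> M12 = N12"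
  by (auto simp: map4_def fun_eq_iff)

text \<open>The type is left open because the same selection by color is applied to the four maps
  and, later, to the four orientations of a quad equation.\<close>

definition local_map :: "'a \<Rightarrow> 'a \<Rightarrow> 'a \<Rightarrow> 'a \<Rightarrow> int \<Rightarrow> int \<Rightarrow> 'a" where
  "local_map M0 M1 M2 M12 n m =
     (if even m then if even n then M0 else M1 else if even n then M2 else M12)"

text \<open>Each power of -1 is a sign given by parity, and the four signs add up to 4 or to 0. Thus
  exactly one weight is 1 at each lattice point.\<close>

lemma wt_simps:
  "wt0 n m = of_bool (even n \<and> even m)"
  "wt1 n m = of_bool (odd n \<and> even m)"
  "wt2 n m = of_bool (even n \<and> odd m)"
  "wt12 n m = of_bool (odd n \<and> odd m)"
  by (auto simp: wt0_def wt1_def wt2_def wt12_def power_int_minus_left)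

lemma sphere_scale_simps [simp]: "0 *\<^sub>S p = Fin 0" "1 *\<^sub>S p = p"
  by (cases p; simp)+

lemma sphere_add_simps [simp]: "Fin 0 +\<^sub>S p = p" "p +\<^sub>S Fin 0 = p"
  by (cases p; simp)+

text \<open>Three of the four summands have weight 0 and reduce to \<open>Fin 0\<close>, even where
  their value is \<open>Infty\<close>; the remaining one has weight 1.\<close>

lemma lift_eq_local_map: "lift M0 M1 M2 M12 = (\<lambda>u n m. local_map M0 M1 M2 M12 n m (u n m))"
  by (auto simp: lift_def wt_simps local_map_def fun_eq_iff)

lemma lift_comp:
  "lift M0 M1 M2 M12 \<circ> lift N0 N1 N2 N12 = lift (M0 \<circ> N0) (M1 \<circ> N1) (M2 \<circ> N2) (M12 \<circ> N12)"
  by (auto simp: lift_eq_local_map local_map_def fun_eq_iff)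

lemma lift_id: "lift id id id id = id"
  by (auto simp: lift_eq_local_map local_map_def fun_eq_iff)

lemma map4_in_carrier:
  "M0 \<in> Moeb \<Longrightarrow> M1 \<in> Moeb \<Longrightarrow> M2 \<in> Moeb \<Longrightarrow> M12 \<in> Moeb \<Longrightarrow>
   map4 M0 M1 M2 M12 \<in> carrier Moeb4"
  unfolding Moeb4_def by simp blast

lemma lift_in_carrier:
  "M0 \<in> Moeb \<Longrightarrow> M1 \<in> Moeb \<Longrightarrow> M2 \<in> Moeb \<Longrightarrow> M12 \<in> Moeb \<Longrightarrow>
   lift M0 M1 M2 M12 \<in> carrier Moeb4_hat"
  unfolding Moeb4_hat_def by simp blast

text \<open>All group laws hold componentwise; \<open>groupI\<close> asks for left inverses, which
  are assembled from inverses of the four components.\<close>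

lemma group_Moeb4: "group Moeb4"
proof (rule groupI)
  fix T assume "T \<in> carrier Moeb4"
  then obtain M0 M1 M2 M12 where
    M: "T = map4 M0 M1 M2 M12" "M0 \<in> Moeb" "M1 \<in> Moeb" "M2 \<in> Moeb" "M12 \<in> Moeb"
    by (auto simp: Moeb4_def)
  obtain N0 N1 N2 N12 where "N0 \<in> Moeb" "N1 \<in> Moeb" "N2 \<in> Moeb" "N12 \<in> Moeb"
    "N0 \<circ> M0 = id" "N1 \<circ> M1 = id" "N2 \<circ> M2 = id" "N12 \<circ> M12 = id"
    using M Moeb_inverse by metis
  then have "map4 N0 N1 N2 N12 \<in> carrier Moeb4" "map4 N0 N1 N2 N12 \<circ> T = id"
    by (simp_all add: M map4_comp map4_id map4_in_carrier)
  then show "\<exists>S\<in>carrier Moeb4. S \<otimes>\<^bsub>Moeb4\<^esub> T = \<one>\<^bsub>Moeb4\<^esub>"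
    by (intro bexI[of _ "map4 N0 N1 N2 N12"]) (simp_all add: Moeb4_def)
next
  show "\<one>\<^bsub>Moeb4\<^esub> \<in> carrier Moeb4"
    using map4_in_carrier[OF Moeb_id Moeb_id Moeb_id Moeb_id]
    by (simp add: map4_id) (simp add: Moeb4_def)
next
  fix S T assume S: "S \<in> carrier Moeb4" and T: "T \<in> carrier Moeb4"
  obtain M0 M1 M2 M12 where "S = map4 M0 M1 M2 M12"
    "M0 \<in> Moeb" "M1 \<in> Moeb" "M2 \<in> Moeb" "M12 \<in> Moeb"
    using S by (auto simp: Moeb4_def)
  moreover obtain N0 N1 N2 N12 where "T = map4 N0 N1 N2 N12"
    "N0 \<in> Moeb" "N1 \<in> Moeb" "N2 \<in> Moeb" "N12 \<in> Moeb"
    using T by (auto simp: Moeb4_def)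
  ultimately have "S \<circ> T \<in> carrier Moeb4"
    by (simp add: map4_comp map4_in_carrier Moeb_comp)
  then show "S \<otimes>\<^bsub>Moeb4\<^esub> T \<in> carrier Moeb4"
    by (simp add: Moeb4_def)
qed (auto simp: Moeb4_def comp_assoc)

lemma group_Moeb4_hat: "group Moeb4_hat"
proof (rule groupI)
  fix T assume "T \<in> carrier Moeb4_hat"
  then obtain M0 M1 M2 M12 where
    M: "T = lift M0 M1 M2 M12" "M0 \<in> Moeb" "M1 \<in> Moeb" "M2 \<in> Moeb" "M12 \<in> Moeb"
    by (auto simp: Moeb4_hat_def)
  obtain N0 N1 N2 N12 where "N0 \<in> Moeb" "N1 \<in> Moeb" "N2 \<in> Moeb" "N12 \<in> Moeb"
    "N0 \<circ> M0 = id" "N1 \<circ> M1 = id" "N2 \<circ> M2 = id" "N12 \<circ> M12 = id"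
    using M Moeb_inverse by metis
  then have "lift N0 N1 N2 N12 \<in> carrier Moeb4_hat" "lift N0 N1 N2 N12 \<circ> T = id"
    by (simp_all add: M lift_comp lift_id lift_in_carrier)
  then show "\<exists>S\<in>carrier Moeb4_hat. S \<otimes>\<^bsub>Moeb4_hat\<^esub> T = \<one>\<^bsub>Moeb4_hat\<^esub>"
    by (intro bexI[of _ "lift N0 N1 N2 N12"]) (simp_all add: Moeb4_hat_def)
next
  show "\<one>\<^bsub>Moeb4_hat\<^esub> \<in> carrier Moeb4_hat"
    using lift_in_carrier[OF Moeb_id Moeb_id Moeb_id Moeb_id]
    by (simp add: lift_id) (simp add: Moeb4_hat_def)
next
  fix S T assume S: "S \<in> carrier Moeb4_hat" and T: "T \<in> carrier Moeb4_hat"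
  obtain M0 M1 M2 M12 where "S = lift M0 M1 M2 M12"
    "M0 \<in> Moeb" "M1 \<in> Moeb" "M2 \<in> Moeb" "M12 \<in> Moeb"
    using S by (auto simp: Moeb4_hat_def)
  moreover obtain N0 N1 N2 N12 where "T = lift N0 N1 N2 N12"
    "N0 \<in> Moeb" "N1 \<in> Moeb" "N2 \<in> Moeb" "N12 \<in> Moeb"
    using T by (auto simp: Moeb4_hat_def)
  ultimately have "S \<circ> T \<in> carrier Moeb4_hat"
    by (simp add: lift_comp lift_in_carrier Moeb_comp)
  then show "S \<otimes>\<^bsub>Moeb4_hat\<^esub> T \<in> carrier Moeb4_hat"
    by (simp add: Moeb4_hat_def)
qed (auto simp: Moeb4_hat_def comp_assoc)

text \<open>Makes lifting a map on the transformations themselves rather than on quadruples of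
  components, so that it can be a homomorphism onto the lifted group.\<close>

lemma lifting_hom:
  "\<exists>h \<in> hom Moeb4 Moeb4_hat.
     h ` carrier Moeb4 = carrier Moeb4_hat \<and>
     (\<forall>M0\<in>Moeb. \<forall>M1\<in>Moeb. \<forall>M2\<in>Moeb. \<forall>M12\<in>Moeb. h (map4 M0 M1 M2 M12) = lift M0 M1 M2 M12)"
proof -
  \<comment> \<open>Each component of \<open>map4\<close> depends on its own argument only, so
    evaluating on the diagonal recovers all four components.\<close>
  define h where "h T = lift (\<lambda>x. fst (T (x, x, x, x))) (\<lambda>x. fst (snd (T (x, x, x, x))))
    (\<lambda>x. fst (snd (snd (T (x, x, x, x))))) (\<lambda>x. snd (snd (snd (T (x, x, x, x)))))" for T
  have h: "h (map4 M0 M1 M2 M12) = lift M0 M1 M2 M12" for M0 M1 M2 M12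
    by (simp add: h_def map4_def)
  have im: "h ` carrier Moeb4 = carrier Moeb4_hat"
  proof
    show "h ` carrier Moeb4 \<subseteq> carrier Moeb4_hat"
    proof
      fix S assume "S \<in> h ` carrier Moeb4"
      then obtain M0 M1 M2 M12 where "S = h (map4 M0 M1 M2 M12)"
        "M0 \<in> Moeb" "M1 \<in> Moeb" "M2 \<in> Moeb" "M12 \<in> Moeb"
        by (auto simp: Moeb4_def)
      then show "S \<in> carrier Moeb4_hat"
        by (simp add: h lift_in_carrier)
    qed
    show "carrier Moeb4_hat \<subseteq> h ` carrier Moeb4"
    proof
      fix T assume "T \<in> carrier Moeb4_hat"
      then obtain M0 M1 M2 M12 where "T = h (map4 M0 M1 M2 M12)"
        "M0 \<in> Moeb" "M1 \<in> Moeb" "M2 \<in> Moeb" "M12 \<in> Moeb"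
        by (auto simp: Moeb4_hat_def h)
      then show "T \<in> h ` carrier Moeb4"
        by (simp add: map4_in_carrier)
    qed
  qed
  have "h \<in> hom Moeb4 Moeb4_hat"
  proof (rule homI)
    fix S T assume "S \<in> carrier Moeb4" "T \<in> carrier Moeb4"
    then obtain M0 M1 M2 M12 N0 N1 N2 N12 where
      "S = map4 M0 M1 M2 M12" "T = map4 N0 N1 N2 N12"
      unfolding Moeb4_def by auto
    then show "h (S \<otimes>\<^bsub>Moeb4\<^esub> T) = h S \<otimes>\<^bsub>Moeb4_hat\<^esub> h T"
      by (simp add: Moeb4_def Moeb4_hat_def h map4_comp lift_comp)
  qed (use im in blast)
  with im h show ?thesis by blast
qed

section \<open>Substitution with denominators cleared\<close>

text \<open>Only the values of \<open>f\<close> at 0 and 1 enter, so the expression makes sense for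
  every \<open>f\<close>, and its rules for products, factors and exchange of variables hold without
  affineness.\<close>

definition subst1 :: "moebius_coeffs \<Rightarrow> (complex \<Rightarrow> complex) \<Rightarrow> complex \<Rightarrow> complex" where
  "subst1 A f z = (f 1 - f 0) * numer A z + f 0 * denom A z"

definition subst4 ::
  "moebius_coeffs \<Rightarrow> moebius_coeffs \<Rightarrow> moebius_coeffs \<Rightarrow> moebius_coeffs \<Rightarrow> quad \<Rightarrow> quad" where
  "subst4 A0 A1 A2 A12 Q = (\<lambda>x x1 x2 x12.
     subst1 A0 (\<lambda>y. subst1 A1 (\<lambda>y1. subst1 A2 (\<lambda>y2. subst1 A12 (Q y y1 y2) x12) x2) x1) x)"

section \<open>Closure properties of affine functions and rules for one-variable
  substitution\<close>

lemma affine_fun_eq: "affine_fun f \<Longrightarrow> f z = (f 1 - f 0) * z + f 0"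
  by (auto simp: affine_fun_def)

lemma affine_fun_const [simp]: "affine_fun (\<lambda>z. c)"
  by (auto simp: affine_fun_def intro: exI[of _ 0])

lemma affine_fun_ident [simp]: "affine_fun (\<lambda>z. z)"
  unfolding affine_fun_def by (rule exI[of _ 1], rule exI[of _ 0]) simp

lemma affine_fun_add [simp]:
  assumes "affine_fun f" "affine_fun g"
  shows "affine_fun (\<lambda>z. f z + g z)"
proof -
  obtain p q p' q' where "\<And>z. f z = p * z + q" "\<And>z. g z = p' * z + q'"
    using assms unfolding affine_fun_def by blast
  then have "f z + g z = (p + p') * z + (q + q')" for z
    by (simp add: algebra_simps)
  then show ?thesis unfolding affine_fun_def by blast
qed

lemma affine_fun_cmult [simp]:
  assumes "affine_fun f"
  shows "affine_fun (\<lambda>z. c * f z)"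
proof -
  obtain p q where "\<And>z. f z = p * z + q"
    using assms unfolding affine_fun_def by blast
  then have "c * f z = (c * p) * z + c * q" for z
    by (simp add: algebra_simps)
  then show ?thesis unfolding affine_fun_def by blast
qed

lemma affine_fun_mult_const [simp]: "affine_fun f \<Longrightarrow> affine_fun (\<lambda>z. f z * c)"
  using affine_fun_cmult[of f c] by (simp add: mult.commute)

lemma affine_fun_divide [simp]: "affine_fun f \<Longrightarrow> affine_fun (\<lambda>z. f z / c)"
  using affine_fun_cmult[of f "1 / c"] by simp

lemma affine_fun_diff [simp]:
  assumes "affine_fun f" "affine_fun g"
  shows "affine_fun (\<lambda>z. f z - g z)"
  using affine_fun_add[OF assms(1) affine_fun_cmult[OF assms(2), of "-1"]] by simp

lemma affine_fun_numer_denom [simp]: "affine_fun (numer A)" "affine_fun (denom A)"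
  by (cases A; auto simp: affine_fun_def)+

lemma affine_fun_subst1 [simp]: "affine_fun (subst1 A f)"
  unfolding subst1_def[abs_def] by simp

text \<open>Substituting in \<open>y\<close> forms a linear combination of \<open>g v 1\<close> and
  \<open>g v 0\<close>, which stays affine in the other variable \<open>v\<close>.\<close>

lemma affine_fun_subst1_arg [simp]:
  assumes "\<And>y. affine_fun (\<lambda>v. g v y)"
  shows "affine_fun (\<lambda>v. subst1 A (\<lambda>y. g v y) z)"
  unfolding subst1_def by (simp add: assms)

lemma subst1_eq:
  assumes "affine_fun f" "denom A z \<noteq> 0"
  shows "subst1 A f z = denom A z * f (numer A z / denom A z)"
  using assms(2) affine_fun_eq[OF assms(1), of "numer A z / denom A z"]
  by (simp add: subst1_def field_simps)

lemma subst1_one: "affine_fun f \<Longrightarrow> subst1 (1, 0, 0, 1) f = f"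
  by (rule ext) (simp add: subst1_def flip: affine_fun_eq)

text \<open>Substituting \<open>A\<close> first and \<open>B\<close> afterwards places
  \<open>B\<close> inside \<open>A\<close>, hence the order of the matrix product.\<close>

lemma subst1_mult: "subst1 B (subst1 A f) = subst1 (mult_coeffs A B) f"
  by (cases A; cases B) (simp add: subst1_def fun_eq_iff algebra_simps)

lemma subst1_scale: "subst1 (scale_coeffs k A) f z = k * subst1 A f z"
  by (cases A) (simp add: subst1_def algebra_simps)

lemma subst1_cmult: "subst1 A (\<lambda>y. k * f y) z = k * subst1 A f z"
  by (simp add: subst1_def algebra_simps)

text \<open>Both sides are the same linear combination of the four values of \<open>f\<close> at
  arguments 0 and 1, summed in different orders.\<close>

lemma subst1_commute:
  "subst1 A (\<lambda>y. subst1 B (\<lambda>z. f y z) v) u = subst1 B (\<lambda>z. subst1 A (\<lambda>y. f y z) u) v"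
  by (simp add: subst1_def algebra_simps)

section \<open>Substitution in all four fields\<close>

lemma affine_linearD:
  assumes "affine_linear Q"
  shows "affine_fun (\<lambda>x. Q x x1 x2 x12)" "affine_fun (\<lambda>x1. Q x x1 x2 x12)"
    "affine_fun (\<lambda>x2. Q x x1 x2 x12)" "affine_fun (Q x x1 x2)"
  using assms by (auto simp: affine_linear_def)

lemma affine_linear_subst4: "affine_linear (subst4 A0 A1 A2 A12 Q)"
  unfolding affine_linear_def subst4_def by simp

lemma subst4_eq:
  assumes "affine_linear Q"
    "denom A0 x \<noteq> 0" "denom A1 x1 \<noteq> 0" "denom A2 x2 \<noteq> 0" "denom A12 x12 \<noteq> 0"
  shows "subst4 A0 A1 A2 A12 Q x x1 x2 x12 =
    denom A0 x * denom A1 x1 * denom A2 x2 * denom A12 x12 *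
      Q (numer A0 x / denom A0 x) (numer A1 x1 / denom A1 x1)
        (numer A2 x2 / denom A2 x2) (numer A12 x12 / denom A12 x12)"
  using assms(2-) by (simp add: subst4_def subst1_eq affine_linearD[OF assms(1)])

lemma subst4_one: "affine_linear Q \<Longrightarrow> subst4 (1, 0, 0, 1) (1, 0, 0, 1) (1, 0, 0, 1) (1, 0, 0, 1) Q = Q"
  by (simp add: subst4_def subst1_one affine_linearD)

lemma subst4_mult:
  "subst4 B0 B1 B2 B12 (subst4 A0 A1 A2 A12 Q) =
   subst4 (mult_coeffs A0 B0) (mult_coeffs A1 B1) (mult_coeffs A2 B2) (mult_coeffs A12 B12) Q"
  \<comment> \<open>The instances move each \<open>A\<close> outward past the \<open>B\<close>s of
    the other fields, until the two substitutions in the same field are adjacent and merge by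
    \<open>subst1_mult\<close>. Fixing the matrices orients the rewriting.\<close>
  by (simp only: subst4_def subst1_mult subst1_commute[of B12 A0] subst1_commute[of B12 A1]
      subst1_commute[of B12 A2] subst1_commute[of B2 A0] subst1_commute[of B2 A1]
      subst1_commute[of B1 A0])

lemma subst4_scale:
  "subst4 (scale_coeffs k0 A0) (scale_coeffs k1 A1) (scale_coeffs k2 A2) (scale_coeffs k12 A12) Q =
   (\<lambda>x x1 x2 x12. k0 * k1 * k2 * k12 * subst4 A0 A1 A2 A12 Q x x1 x2 x12)"
  by (simp add: subst4_def subst1_scale subst1_cmult fun_eq_iff)

text \<open>Two affine functions that agree at two points are equal, and a nondegenerate denominator
  is nonzero at two points at least.\<close>

lemma affine_fun_eqI:
  assumes f: "affine_fun f" and g: "affine_fun g" and "nondeg A"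
    and eq: "\<And>z. denom A z \<noteq> 0 \<Longrightarrow> f z = g z"
  shows "f = g"
proof -
  obtain a b c d where A: "A = (a, b, c, d)" by (cases A)
  obtain p q where h: "\<And>z. f z - g z = p * z + q"
    using affine_fun_diff[OF f g] by (auto simp: affine_fun_def)
  have "\<exists>z w. denom A z \<noteq> 0 \<and> denom A w \<noteq> 0 \<and> z \<noteq> w"
  proof (cases "c = 0")
    case True
    with \<open>nondeg A\<close> have "denom A 0 \<noteq> 0" "denom A 1 \<noteq> 0" by (auto simp: A)
    then show ?thesis by (metis zero_neq_one)
  next
    case False
    \<comment> \<open>The points are chosen so that the denominator takes the values 1 and
      2.\<close>
    then have "denom A ((1 - d) / c) \<noteq> 0" "denom A ((2 - d) / c) \<noteq> 0" "(1 - d) / c \<noteq> (2 - d) / c"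
      by (auto simp: A)
    then show ?thesis by blast
  qed
  then obtain z w where "p * z + q = 0" "p * w + q = 0" "z \<noteq> w"
    using h eq by (metis right_minus_eq)
  moreover have "p * (z - w) = (p * z + q) - (p * w + q)" by (simp add: algebra_simps)
  ultimately have "p * (z - w) = 0" by simp
  with \<open>z \<noteq> w\<close> \<open>p * z + q = 0\<close> have "p = 0" "q = 0" by simp_all
  then show ?thesis using h by (auto simp: fun_eq_iff)
qed

lemma affine_linear_eqI:
  assumes P: "affine_linear P" and Q: "affine_linear Q"
    and A: "nondeg A0" "nondeg A1" "nondeg A2" "nondeg A12"
    and eq: "\<And>x x1 x2 x12. denom A0 x \<noteq> 0 \<Longrightarrow> denom A1 x1 \<noteq> 0 \<Longrightarrow> denom A2 x2 \<noteq> 0 \<Longrightarrow>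
      denom A12 x12 \<noteq> 0 \<Longrightarrow> P x x1 x2 x12 = Q x x1 x2 x12"
  shows "P = Q"
proof -
  note affP = affine_linearD[OF P] and affQ = affine_linearD[OF Q]
  \<comment> \<open>The restriction on the arguments is removed one field at a time, starting with
    \<open>x12\<close>.\<close>
  have 1: "P x x1 x2 x12 = Q x x1 x2 x12"
    if "denom A0 x \<noteq> 0" "denom A1 x1 \<noteq> 0" "denom A2 x2 \<noteq> 0" for x x1 x2 x12
    using fun_cong[OF affine_fun_eqI[OF affP(4) affQ(4) A(4) eq]] that by blast
  have 2: "P x x1 x2 x12 = Q x x1 x2 x12" if "denom A0 x \<noteq> 0" "denom A1 x1 \<noteq> 0" for x x1 x2 x12
    using fun_cong[OF affine_fun_eqI[OF affP(3) affQ(3) A(3) 1]] that by blast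
  have 3: "P x x1 x2 x12 = Q x x1 x2 x12" if "denom A0 x \<noteq> 0" for x x1 x2 x12
    using fun_cong[OF affine_fun_eqI[OF affP(2) affQ(2) A(2) 2]] that by blast
  have "P x x1 x2 x12 = Q x x1 x2 x12" for x x1 x2 x12
    using fun_cong[OF affine_fun_eqI[OF affP(1) affQ(1) A(1) 3]] by blast
  then show ?thesis by (simp add: fun_eq_iff)
qed

text \<open>The values off the zeros of the denominators determine an affine linear polynomial, so
  the conditional description becomes an explicit equation for \<open>P\<close>.\<close>

lemma substituted_iff_subst4:
  assumes Q: "affine_linear Q"
  shows "substituted M0 M1 M2 M12 Q P \<longleftrightarrow>
    (\<exists>A0 A1 A2 A12. nondeg A0 \<and> nondeg A1 \<and> nondeg A2 \<and> nondeg A12 \<and>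
      M0 = moebius A0 \<and> M1 = moebius A1 \<and> M2 = moebius A2 \<and> M12 = moebius A12 \<and>
      P = subst4 A0 A1 A2 A12 Q)" (is "?L \<longleftrightarrow> ?R")
proof
  assume ?L
  then obtain A0 A1 A2 A12 where P: "affine_linear P"
    and A: "nondeg A0" "nondeg A1" "nondeg A2" "nondeg A12"
    and M: "M0 = moebius A0" "M1 = moebius A1" "M2 = moebius A2" "M12 = moebius A12"
    and eq: "\<And>x x1 x2 x12. denom A0 x \<noteq> 0 \<Longrightarrow> denom A1 x1 \<noteq> 0 \<Longrightarrow> denom A2 x2 \<noteq> 0 \<Longrightarrow>
      denom A12 x12 \<noteq> 0 \<Longrightarrow> P x x1 x2 x12 = denom A0 x * denom A1 x1 * denom A2 x2 * denom A12 x12 *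
      Q (numer A0 x / denom A0 x) (numer A1 x1 / denom A1 x1)
        (numer A2 x2 / denom A2 x2) (numer A12 x12 / denom A12 x12)"
    unfolding substituted_def by blast
  have "P = subst4 A0 A1 A2 A12 Q"
    by (rule affine_linear_eqI[OF P affine_linear_subst4 A]) (simp add: eq subst4_eq[OF Q])
  with A M show ?R by blast
next
  assume ?R
  then obtain A0 A1 A2 A12 where A: "nondeg A0" "nondeg A1" "nondeg A2" "nondeg A12"
    and M: "M0 = moebius A0" "M1 = moebius A1" "M2 = moebius A2" "M12 = moebius A12"
    and P: "P = subst4 A0 A1 A2 A12 Q"
    by blast
  show ?L
    unfolding substituted_def P using A M subst4_eq[OF Q] affine_linear_subst4 by blast
qed

section \<open>Existence, composition, inversion and uniqueness of transformed equations\<close>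

lemma substituted_affine: "substituted M0 M1 M2 M12 Q P \<Longrightarrow> affine_linear P"
  by (simp add: substituted_def)

text \<open>Recovers membership in the group from the relation between the equations alone, since
  that relation provides nondegenerate coefficients.\<close>

lemma substituted_Moeb:
  assumes "substituted M0 M1 M2 M12 Q P"
  shows "M0 \<in> Moeb" "M1 \<in> Moeb" "M2 \<in> Moeb" "M12 \<in> Moeb"
  using assms by (auto simp: substituted_def Moeb_def)

lemma substituted_exists:
  assumes "affine_linear Q" "M0 \<in> Moeb" "M1 \<in> Moeb" "M2 \<in> Moeb" "M12 \<in> Moeb"
  shows "\<exists>P. substituted M0 M1 M2 M12 Q P"
  using assms(2-) unfolding substituted_iff_subst4[OF assms(1)] Moeb_def by blast

lemma substituted_id: "affine_linear Q \<Longrightarrow> substituted id id id id Q Q"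
  unfolding substituted_iff_subst4
  by (rule exI[of _ "(1, 0, 0, 1)"])+ (simp add: moebius_one subst4_one)

text \<open>The second substitution acts on the arguments of the first, so the maps compose as
  \<open>M0 \<circ> N0\<close> and not the other way round.\<close>

lemma substituted_comp:
  assumes Q: "affine_linear Q"
    and QP: "substituted M0 M1 M2 M12 Q P" and PR: "substituted N0 N1 N2 N12 P R"
  shows "substituted (M0 \<circ> N0) (M1 \<circ> N1) (M2 \<circ> N2) (M12 \<circ> N12) Q R"
proof -
  obtain A0 A1 A2 A12 where A: "nondeg A0" "nondeg A1" "nondeg A2" "nondeg A12"
    and M: "M0 = moebius A0" "M1 = moebius A1" "M2 = moebius A2" "M12 = moebius A12"
    and P: "P = subst4 A0 A1 A2 A12 Q"
    using QP unfolding substituted_iff_subst4[OF Q] by blast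
  obtain B0 B1 B2 B12 where B: "nondeg B0" "nondeg B1" "nondeg B2" "nondeg B12"
    and N: "N0 = moebius B0" "N1 = moebius B1" "N2 = moebius B2" "N12 = moebius B12"
    and R: "R = subst4 B0 B1 B2 B12 P"
    using PR unfolding substituted_iff_subst4[OF substituted_affine[OF QP]] by blast
  have R': "R = subst4 (mult_coeffs A0 B0) (mult_coeffs A1 B1) (mult_coeffs A2 B2)
      (mult_coeffs A12 B12) Q"
    by (simp add: R P subst4_mult)
  note moebius_mult[OF A(1) B(1)] moebius_mult[OF A(2) B(2)]
    moebius_mult[OF A(3) B(3)] moebius_mult[OF A(4) B(4)]
  with R' show ?thesis
    unfolding substituted_iff_subst4[OF Q] M N using A B nondeg_mult by metis
qed

lemma substituted_inverse:
  assumes Q: "affine_linear Q" and QP: "substituted M0 M1 M2 M12 Q P"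
    and N: "M0 \<circ> N0 = id" "M1 \<circ> N1 = id" "M2 \<circ> N2 = id" "M12 \<circ> N12 = id"
  shows "substituted N0 N1 N2 N12 P Q"
proof -
  obtain A0 A1 A2 A12 where A: "nondeg A0" "nondeg A1" "nondeg A2" "nondeg A12"
    and M: "M0 = moebius A0" "M1 = moebius A1" "M2 = moebius A2" "M12 = moebius A12"
    and P: "P = subst4 A0 A1 A2 A12 Q"
    using QP unfolding substituted_iff_subst4[OF Q] by blast
  have inv: "K = moebius (inv_coeffs A)" if "nondeg A" "moebius A \<circ> K = id" for A K
  proof -
    have "moebius (inv_coeffs A) \<circ> moebius A = id"
      using that by (simp add: nondeg_inv mult_inv_coeffs moebius_one flip: moebius_mult)
    \<comment> \<open>A right inverse agrees with the left inverse given by the inverse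
      matrix.\<close>
    then show ?thesis using that(2) by (metis comp_assoc comp_id id_comp)
  qed
  have "N0 = moebius (inv_coeffs A0)" "N1 = moebius (inv_coeffs A1)"
    "N2 = moebius (inv_coeffs A2)" "N12 = moebius (inv_coeffs A12)"
    using inv A N M by blast+
  moreover have "Q = subst4 (inv_coeffs A0) (inv_coeffs A1) (inv_coeffs A2) (inv_coeffs A12) P"
    by (simp add: P subst4_mult mult_inv_coeffs A subst4_one Q)
  ultimately show ?thesis
    unfolding substituted_iff_subst4[OF substituted_affine[OF QP]] using A nondeg_inv by blast
qed

text \<open>Coefficients of the same Moebius maps differ by nonzero factors, whose product
  multiplies the polynomial. Conversely, any nonzero factor can be absorbed into the
  coefficients.\<close>

lemma substituted_unique:
  assumes Q: "affine_linear Q" and QP: "substituted M0 M1 M2 M12 Q P"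
  shows "substituted M0 M1 M2 M12 Q R \<longleftrightarrow>
    (\<exists>k. k \<noteq> 0 \<and> (\<forall>x x1 x2 x12. R x x1 x2 x12 = k * P x x1 x2 x12))"
proof
  obtain A0 A1 A2 A12 where A: "nondeg A0" "nondeg A1" "nondeg A2" "nondeg A12"
    and M: "M0 = moebius A0" "M1 = moebius A1" "M2 = moebius A2" "M12 = moebius A12"
    and P: "P = subst4 A0 A1 A2 A12 Q"
    using QP unfolding substituted_iff_subst4[OF Q] by blast
  {
    assume "substituted M0 M1 M2 M12 Q R"
    then obtain B0 B1 B2 B12 where B: "nondeg B0" "nondeg B1" "nondeg B2" "nondeg B12"
      and N: "M0 = moebius B0" "M1 = moebius B1" "M2 = moebius B2" "M12 = moebius B12"
      and R: "R = subst4 B0 B1 B2 B12 Q"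
      unfolding substituted_iff_subst4[OF Q] by blast
    obtain k0 k1 k2 k12 where "k0 \<noteq> 0" "k1 \<noteq> 0" "k2 \<noteq> 0" "k12 \<noteq> 0"
      "B0 = scale_coeffs k0 A0" "B1 = scale_coeffs k1 A1"
      "B2 = scale_coeffs k2 A2" "B12 = scale_coeffs k12 A12"
      using A B M N moebius_eq_imp_scale by metis
    then show "\<exists>k. k \<noteq> 0 \<and> (\<forall>x x1 x2 x12. R x x1 x2 x12 = k * P x x1 x2 x12)"
      by (intro exI[of _ "k0 * k1 * k2 * k12"]) (simp add: R P subst4_scale)
  next
    assume "\<exists>k. k \<noteq> 0 \<and> (\<forall>x x1 x2 x12. R x x1 x2 x12 = k * P x x1 x2 x12)"
    then obtain k where k: "k \<noteq> 0" and R: "\<And>x x1 x2 x12. R x x1 x2 x12 = k * P x x1 x2 x12"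
      by blast
    \<comment> \<open>The whole factor is put into the coefficients of the first map.\<close>
    have "R = subst4 (scale_coeffs k A0) A1 A2 A12 Q"
      by (simp add: R P subst4_def subst1_scale fun_eq_iff)
    moreover have "nondeg (scale_coeffs k A0)" "M0 = moebius (scale_coeffs k A0)"
      using k A M by (simp_all add: nondeg_scale moebius_scale)
    ultimately show "substituted M0 M1 M2 M12 Q R"
      unfolding substituted_iff_subst4[OF Q] using A M by blast
  }
qed

section \<open>Equivalence of equations\<close>

text \<open>Identity, inverses and composition in the group give reflexivity, symmetry and
  transitivity.\<close>

lemma equiv_quad_equivalence: "equiv {Q. affine_linear Q} quad_equivalence"
proof (rule equivI)
  show "quad_equivalence \<subseteq> {Q. affine_linear Q} \<times> {Q. affine_linear Q}"
    by (auto simp: quad_equivalence_def)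
  show "refl_on {Q. affine_linear Q} quad_equivalence"
  proof (rule refl_onI)
    fix Q assume "Q \<in> {Q. affine_linear Q}"
    then have "affine_linear Q" by simp
    moreover from this have "quad_transformed (map4 id id id id) Q Q"
      using substituted_id unfolding quad_transformed_def by blast
    moreover have "map4 id id id id \<in> carrier Moeb4"
      by (simp add: map4_in_carrier Moeb_id)
    ultimately show "(Q, Q) \<in> quad_equivalence"
      unfolding quad_equivalence_def by blast
  qed
  show "sym quad_equivalence"
  proof (rule symI)
    fix Q P assume QP: "(Q, P) \<in> quad_equivalence"
    then obtain M0 M1 M2 M12 where aff: "affine_linear Q" "affine_linear P"
      and s: "substituted M0 M1 M2 M12 Q P"
      unfolding quad_equivalence_def quad_transformed_def by blast
    obtain N0 N1 N2 N12 where N: "N0 \<in> Moeb" "N1 \<in> Moeb" "N2 \<in> Moeb" "N12 \<in> Moeb"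
      "M0 \<circ> N0 = id" "M1 \<circ> N1 = id" "M2 \<circ> N2 = id" "M12 \<circ> N12 = id"
      using substituted_Moeb[OF s] Moeb_inverse by metis
    then have "quad_transformed (map4 N0 N1 N2 N12) P Q" "map4 N0 N1 N2 N12 \<in> carrier Moeb4"
      using substituted_inverse[OF aff(1) s N(5-8)]
      by (auto simp: quad_transformed_def map4_in_carrier)
    with aff show "(P, Q) \<in> quad_equivalence"
      unfolding quad_equivalence_def by blast
  qed
  show "trans quad_equivalence"
  proof (rule transI)
    fix Q P R assume "(Q, P) \<in> quad_equivalence" "(P, R) \<in> quad_equivalence"
    then obtain M0 M1 M2 M12 N0 N1 N2 N12 where aff: "affine_linear Q" "affine_linear R"
      and s: "substituted M0 M1 M2 M12 Q P" "substituted N0 N1 N2 N12 P R"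
      unfolding quad_equivalence_def quad_transformed_def by blast
    note s' = substituted_comp[OF aff(1) s]
    have "map4 (M0 \<circ> N0) (M1 \<circ> N1) (M2 \<circ> N2) (M12 \<circ> N12) \<in> carrier Moeb4"
      using substituted_Moeb[OF s'] by (simp add: map4_in_carrier)
    with aff s' show "(Q, R) \<in> quad_equivalence"
      unfolding quad_equivalence_def quad_transformed_def by blast
  qed
qed

text \<open>A transformation of the field determines its local maps, so the existential choice of
  them can be replaced by \<open>local_map\<close>.\<close>

lemma lattice_transformed_lift:
  fixes M0 M1 M2 M12
  defines "L \<equiv> local_map M0 M1 M2 M12"
  shows "lattice_transformed (lift M0 M1 M2 M12) E E' \<longleftrightarrow>
    (\<forall>n m. substituted (L n m) (L (n + 1) m) (L n (m + 1)) (L (n + 1) (m + 1)) (E n m) (E' n m))"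
proof -
  have "L' = L" if "lift M0 M1 M2 M12 = (\<lambda>u n m. L' n m (u n m))" for L'
  proof (intro ext)
    fix n m p
    show "L' n m p = L n m p"
      \<comment> \<open>Constant fields suffice: every point \<open>p\<close> of the sphere occurs
        as the value at \<open>(n, m)\<close>.\<close>
      using fun_cong[OF fun_cong[OF fun_cong[OF that, of "\<lambda>_ _. p"], of n], of m]
      by (simp add: lift_eq_local_map L_def)
  qed
  then show ?thesis
    unfolding lattice_transformed_def using lift_eq_local_map L_def by blast
qed

lemma local_map_comp:
  "local_map M0 M1 M2 M12 n m \<circ> local_map N0 N1 N2 N12 n m =
   local_map (M0 \<circ> N0) (M1 \<circ> N1) (M2 \<circ> N2) (M12 \<circ> N12) n m"
  by (simp add: local_map_def)

lemma local_map_const: "local_map M M M M n m = M"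
  by (simp add: local_map_def)

text \<open>The laws for a single quad are applied cell by cell; the local maps compose and invert
  pointwise because the color at a lattice point is fixed.\<close>

lemma equiv_lattice_equivalence: "equiv {E. \<forall>n m. affine_linear (E n m)} lattice_equivalence"
proof (rule equivI)
  show "lattice_equivalence \<subseteq>
      {E. \<forall>n m. affine_linear (E n m)} \<times> {E. \<forall>n m. affine_linear (E n m)}"
    by (auto simp: lattice_equivalence_def)
  show "refl_on {E. \<forall>n m. affine_linear (E n m)} lattice_equivalence"
  proof (rule refl_onI)
    fix E :: lattice_eq assume "E \<in> {E. \<forall>n m. affine_linear (E n m)}"
    then have aff: "\<forall>n m. affine_linear (E n m)" by simp
    then have "lattice_transformed (lift id id id id) E E"
      by (simp add: lattice_transformed_lift local_map_const substituted_id)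
    moreover have "lift id id id id \<in> carrier Moeb4_hat"
      by (simp add: lift_in_carrier Moeb_id)
    ultimately show "(E, E) \<in> lattice_equivalence"
      using aff unfolding lattice_equivalence_def by blast
  qed
  show "sym lattice_equivalence"
  proof (rule symI)
    fix E E' assume "(E, E') \<in> lattice_equivalence"
    then obtain M0 M1 M2 M12 where
      aff: "\<And>n m. affine_linear (E n m)" "\<And>n m. affine_linear (E' n m)"
      and M: "M0 \<in> Moeb" "M1 \<in> Moeb" "M2 \<in> Moeb" "M12 \<in> Moeb"
      and t: "lattice_transformed (lift M0 M1 M2 M12) E E'"
      unfolding lattice_equivalence_def Moeb4_hat_def by auto
    obtain N0 N1 N2 N12 where N: "N0 \<in> Moeb" "N1 \<in> Moeb" "N2 \<in> Moeb" "N12 \<in> Moeb"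
      "M0 \<circ> N0 = id" "M1 \<circ> N1 = id" "M2 \<circ> N2 = id" "M12 \<circ> N12 = id"
      using M Moeb_inverse by metis
    have "local_map M0 M1 M2 M12 n m \<circ> local_map N0 N1 N2 N12 n m = id" for n m
      by (simp add: local_map_comp N local_map_const)
    then have "lattice_transformed (lift N0 N1 N2 N12) E' E"
      using t substituted_inverse[OF aff(1)] unfolding lattice_transformed_lift by blast
    moreover have "lift N0 N1 N2 N12 \<in> carrier Moeb4_hat"
      using N by (simp add: lift_in_carrier)
    ultimately show "(E', E) \<in> lattice_equivalence"
      using aff unfolding lattice_equivalence_def by blast
  qed
  show "trans lattice_equivalence"
  proof (rule transI)
    fix E E' E'' assume "(E, E') \<in> lattice_equivalence" "(E', E'') \<in> lattice_equivalence"
    then obtain S T where aff: "\<And>n m. affine_linear (E n m)" "\<And>n m. affine_linear (E'' n m)"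
      and ST: "S \<in> carrier Moeb4_hat" "T \<in> carrier Moeb4_hat"
        "lattice_transformed S E E'" "lattice_transformed T E' E''"
      unfolding lattice_equivalence_def by blast
    obtain M0 M1 M2 M12 where S: "S = lift M0 M1 M2 M12"
      and M: "M0 \<in> Moeb" "M1 \<in> Moeb" "M2 \<in> Moeb" "M12 \<in> Moeb"
      using ST(1) by (auto simp: Moeb4_hat_def)
    obtain N0 N1 N2 N12 where T: "T = lift N0 N1 N2 N12"
      and N: "N0 \<in> Moeb" "N1 \<in> Moeb" "N2 \<in> Moeb" "N12 \<in> Moeb"
      using ST(2) by (auto simp: Moeb4_hat_def)
    note t = ST(3,4)[unfolded S T lattice_transformed_lift]
    have "lattice_transformed (lift (M0 \<circ> N0) (M1 \<circ> N1) (M2 \<circ> N2) (M12 \<circ> N12)) E E''"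
      unfolding lattice_transformed_lift local_map_comp[symmetric]
      using t substituted_comp[OF aff(1)] by blast
    moreover have "lift (M0 \<circ> N0) (M1 \<circ> N1) (M2 \<circ> N2) (M12 \<circ> N12) \<in> carrier Moeb4_hat"
      using M N by (simp add: lift_in_carrier Moeb_comp)
    ultimately show "(E, E'') \<in> lattice_equivalence"
      using aff unfolding lattice_equivalence_def by blast
  qed
qed

section \<open>Lifting of transformed equations\<close>

text \<open>Each listed left-hand side is built by operations that the closure rules for
  \<open>affine_fun\<close> cover in every single field. This is how the list enters the final
  theorem.\<close>

lemma affine_linear_quad_equations:
  assumes "Q \<in> quad_equations"
  shows "affine_linear Q"
  using assms
  by (auto simp: quad_equations_def affine_linear_def tH1_def tH2_def tH3_def D1_def D2_1_def
      D3_def D4_1_def D2_2_def D2_3_def D4_2_def)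

lemma lattice_equation_eq:
  "lattice_equation Q n m = local_map Q (\<lambda>x x1 x2 x12. Q x1 x x12 x2)
     (\<lambda>x x1 x2 x12. Q x2 x12 x x1) (\<lambda>x x1 x2 x12. Q x12 x2 x1 x) n m"
  by (auto simp: lattice_equation_def wt_simps local_map_def fun_eq_iff)

lemma affine_linear_lattice_equation: "affine_linear Q \<Longrightarrow> affine_linear (lattice_equation Q n m)"
  by (auto simp: lattice_equation_eq local_map_def affine_linear_def)

text \<open>The two reflections of the square rename fields and maps together, which only reorders
  the product of the denominators. Their composition gives the half-turn that exchanges
  \<open>x\<close> with \<open>x12\<close> and \<open>x1\<close> with \<open>x2\<close>.\<close>

lemma substituted_permute:
  assumes "substituted M0 M1 M2 M12 Q P"
  shows "substituted M1 M0 M12 M2 (\<lambda>x x1 x2 x12. Q x1 x x12 x2) (\<lambda>x x1 x2 x12. P x1 x x12 x2)"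
    and "substituted M2 M12 M0 M1 (\<lambda>x x1 x2 x12. Q x2 x12 x x1) (\<lambda>x x1 x2 x12. P x2 x12 x x1)"
proof -
  obtain A0 A1 A2 A12 where P: "affine_linear P"
    and A: "nondeg A0" "nondeg A1" "nondeg A2" "nondeg A12"
    and M: "M0 = moebius A0" "M1 = moebius A1" "M2 = moebius A2" "M12 = moebius A12"
    and eq: "\<And>x x1 x2 x12. denom A0 x \<noteq> 0 \<Longrightarrow> denom A1 x1 \<noteq> 0 \<Longrightarrow> denom A2 x2 \<noteq> 0 \<Longrightarrow>
      denom A12 x12 \<noteq> 0 \<Longrightarrow> P x x1 x2 x12 = denom A0 x * denom A1 x1 * denom A2 x2 * denom A12 x12 *
      Q (numer A0 x / denom A0 x) (numer A1 x1 / denom A1 x1)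
        (numer A2 x2 / denom A2 x2) (numer A12 x12 / denom A12 x12)"
    using assms unfolding substituted_def by blast
  show "substituted M1 M0 M12 M2 (\<lambda>x x1 x2 x12. Q x1 x x12 x2) (\<lambda>x x1 x2 x12. P x1 x x12 x2)"
    unfolding substituted_def
    using P by (intro conjI exI[of _ A1] exI[of _ A0] exI[of _ A12] exI[of _ A2])
      (auto simp: affine_linear_def A M eq)
  show "substituted M2 M12 M0 M1 (\<lambda>x x1 x2 x12. Q x2 x12 x x1) (\<lambda>x x1 x2 x12. P x2 x12 x x1)"
    unfolding substituted_def
    using P by (intro conjI exI[of _ A2] exI[of _ A12] exI[of _ A0] exI[of _ A1])
      (auto simp: affine_linear_def A M eq)
qed

text \<open>Moving the origin of the cell by one step exchanges colors. The local maps at its four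
  corners are thus permuted by the same reflection or half-turn that orients \<open>Q\<close>
  there.\<close>

lemma substituted_lattice_equation:
  fixes M0 M1 M2 M12
  defines "L \<equiv> local_map M0 M1 M2 M12"
  assumes "substituted M0 M1 M2 M12 Q P"
  shows "substituted (L n m) (L (n + 1) m) (L n (m + 1)) (L (n + 1) (m + 1))
    (lattice_equation Q n m) (lattice_equation P n m)"
  using assms(2) substituted_permute[OF assms(2)]
    substituted_permute(2)[OF substituted_permute(1)[OF assms(2)]]
  by (simp add: L_def lattice_equation_eq local_map_def)

text \<open>At each lattice point the lifted \<open>P\<close> is one result of the transformation,
  and the others are its nonzero multiples; choosing a factor at every point yields the function
  \<open>k\<close> of \<open>same_lattice_eq\<close>.\<close>

lemma lattice_transformed_iff_same:
  assumes Q: "affine_linear Q" and QP: "substituted M0 M1 M2 M12 Q P"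
  shows "lattice_transformed (lift M0 M1 M2 M12) (lattice_equation Q) E \<longleftrightarrow>
    same_lattice_eq E (lattice_equation P)"
  unfolding lattice_transformed_lift same_lattice_eq_def
    substituted_unique[OF affine_linear_lattice_equation[OF Q] substituted_lattice_equation[OF QP]]
  by metis

theorem theorem2:
  shows "group Moeb4 \<and> group Moeb4_hat \<and>
    (\<exists>h \<in> hom Moeb4 Moeb4_hat.
       h ` carrier Moeb4 = carrier Moeb4_hat \<and>
       (\<forall>M0\<in>Moeb. \<forall>M1\<in>Moeb. \<forall>M2\<in>Moeb. \<forall>M12\<in>Moeb.
          h (map4 M0 M1 M2 M12) = lift M0 M1 M2 M12)) \<and>
    equiv {Q. affine_linear Q} quad_equivalence \<and>
    equiv {E. \<forall>n m. affine_linear (E n m)} lattice_equivalence \<and>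
    (\<forall>Q\<in>quad_equations. \<forall>M0\<in>Moeb. \<forall>M1\<in>Moeb. \<forall>M2\<in>Moeb. \<forall>M12\<in>Moeb.
       (\<exists>P. quad_transformed (map4 M0 M1 M2 M12) Q P) \<and>
       (\<forall>P. quad_transformed (map4 M0 M1 M2 M12) Q P \<longrightarrow>
          (\<forall>E. lattice_transformed (lift M0 M1 M2 M12) (lattice_equation Q) E
                 \<longleftrightarrow> same_lattice_eq E (lattice_equation P))))"
proof (intro conjI ballI allI impI)
  fix Q M0 M1 M2 M12 assume "Q \<in> quad_equations"
    and M: "M0 \<in> Moeb" "M1 \<in> Moeb" "M2 \<in> Moeb" "M12 \<in> Moeb"
  then have Q: "affine_linear Q" by (simp add: affine_linear_quad_equations)
  show "\<exists>P. quad_transformed (map4 M0 M1 M2 M12) Q P"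
    using substituted_exists[OF Q M] unfolding quad_transformed_def by blast
  fix P E assume "quad_transformed (map4 M0 M1 M2 M12) Q P"
  \<comment> \<open>The components hidden in \<open>quad_transformed\<close> are the given ones,
    because \<open>map4\<close> is injective.\<close>
  then have "substituted M0 M1 M2 M12 Q P"
    by (auto simp: quad_transformed_def map4_inject)
  with Q show "lattice_transformed (lift M0 M1 M2 M12) (lattice_equation Q) E \<longleftrightarrow>
      same_lattice_eq E (lattice_equation P)"
    by (rule lattice_transformed_iff_same)
qed (rule group_Moeb4 group_Moeb4_hat lifting_hom equiv_quad_equivalence equiv_lattice_equivalence)+

end
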